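(* Let $h$ be a regularly varying function with index $\rho\in\mathbb{R}$, and write $h(x)=x^{\rho}L(x)$, where $L$ is slowly varying. Then for all sufficiently large $a>0$ we have $$C_a[h(x)] \;=\; x^{\rho}\int_a^{x/a}L(u)L\Bigl(\frac{x}{u}\Bigr)\frac{du}{u} \;=\; x^{\rho}\,C_a[L(x)],$$ and the function $x\mapsto C_a[L(x)]$ is slowly varying.
   Context: A function $h$ is regularly varying if it is positive and measurable (e.g. continuous) for $x\ge x_0$ for some $x_0>0$, and there is $\rho\in\mathbb{R}$ (its index) such that $\lim_{x\to\infty}h(cx)/h(x)=c^{\rho}$ for every $c>0$. It is slowly varying if it is regularly varying with index $\rho=0$. Every regularly varying $h$ of index $\rho$ can be written as $h(x)=x^\rho L(x)$ with $L$ slowly varying. For $a>0$ and a function $f$ defined on $[a,\infty)$, the convolution is $C_a[f(x)] := \int_a^{x/a} f(y)f(x/y)\,\frac{dy}{y}$ for $x\ge a$. *)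

theory Defs
  imports "HOL-Analysis.Analysis"
begin

text \<open>Functions are total on the reals; only their values on some half-line matter.
  Measurability is Lebesgue measurability, as is usual for regular variation.\<close>

definition regularly_varying :: "(real \<Rightarrow> real) \<Rightarrow> real \<Rightarrow> bool" where
  "regularly_varying h \<rho> \<longleftrightarrow>
     (\<exists>x0>0. (\<forall>x\<ge>x0. h x > 0) \<and> h \<in> borel_measurable (lebesgue_on {x0..})) \<and>
     (\<forall>c>0. ((\<lambda>x. h (c * x) / h x) \<longlongrightarrow> c powr \<rho>) at_top)"

definition slowly_varying :: "(real \<Rightarrow> real) \<Rightarrow> bool" where
  "slowly_varying L \<longleftrightarrow> regularly_varying L 0"

text \<open>The convolution \<open>C\<^sub>a[f]\<close>. Both arguments \<open>y\<close> and \<open>x / y\<close> stay in \<open>{a..}\<close>.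
  For \<open>a \<le> x < a\<^sup>2\<close> the range of integration is empty and the value is 0 (the oriented
  integral would involve values of \<open>f\<close> outside its domain \<open>{a..}\<close>). The measure is
  \<open>lebesgue\<close> rather than \<open>lborel\<close> because \<open>f\<close> need not be Borel.\<close>

definition mult_conv :: "real \<Rightarrow> (real \<Rightarrow> real) \<Rightarrow> real \<Rightarrow> real" where
  "mult_conv a f x = (LINT y:{a..x/a}|lebesgue. f y * f (x / y) / y)"

end

theory Submission
  imports Defs
begin

text \<open>Let \<open>C = C\<^sub>a[L]\<close>, \<open>s = sqrt x\<close> and \<open>c > 1\<close>. In \<open>C (c x) = \<integral> L(u) L(c x / u) du / u\<close> either \<open>x / u\<close> or \<open>u\<close>
  is at least \<open>s\<close>: for \<open>u \<le> s\<close> replace \<open>L(c x / u)\<close> by \<open>L(x / u)\<close>, and for \<open>u \<ge> s\<close> substitute \<open>u = c v\<close> and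
  replace \<open>L(c v)\<close> by \<open>L(v)\<close>. Only the pointwise limit at the single factor \<open>c\<close> is needed, and the
  result is \<open>C (c x) \<sim> C (x) + J (x)\<close>, where \<open>J (x)\<close> is the integral of \<open>L(v) L(x / v) / v\<close> over the overlap
  \<open>[s / c, s]\<close>. The same substitution shows that the integral over each block
  \<open>[s / c\<^bsup>k+1\<^esup>, s / c\<^bsup>k\<^esup>]\<close> is eventually at least \<open>J (x) / 2\<close>, so \<open>J = o(C)\<close>.
  Integrability needs \<open>L\<close> to be locally bounded far out, which is where measurability enters.\<close>

section \<open>Doubling bound and local boundedness of slowly varying functions\<close>

text \<open>Pointwise convergence makes the sets \<open>A n\<close> increase to all of
  \<open>S\<close>, and measure is continuous from below. This is the weak form of Egorov's theorem
  that the doubling bound needs.\<close>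

lemma tail_sets_measure_tendsto:
  fixes f :: "nat \<Rightarrow> 'a::euclidean_space \<Rightarrow> real"
  assumes S: "S \<in> lmeasurable"
    and meas: "\<And>m. f m \<in> borel_measurable (lebesgue_on S)"
    and lim: "\<And>s. s \<in> S \<Longrightarrow> (\<lambda>m. f m s) \<longlonglongrightarrow> l" and "0 < e"
  defines "A \<equiv> \<lambda>n. {s \<in> S. \<forall>m\<ge>n. \<bar>f m s - l\<bar> < e}"
  shows "A n \<in> lmeasurable" and "(\<lambda>n. measure lebesgue (A n)) \<longlonglongrightarrow> measure lebesgue S"
proof -
  have SL: "S \<in> sets lebesgue" using S by auto
  have sets: "A n \<in> sets lebesgue" for n
  proof -
    let ?D = "\<lambda>m. {s \<in> space (lebesgue_on S). \<bar>f m s - l\<bar> < e}"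
    have "(\<lambda>s. \<bar>f m s - l\<bar>) \<in> borel_measurable (lebesgue_on S)" for m
      using meas[of m] by (intro borel_measurable_abs borel_measurable_diff borel_measurable_const)
    then have "?D m \<in> sets (lebesgue_on S)" for m
      by (rule borel_measurable_less[OF _ borel_measurable_const])
    then have "(\<Inter>m\<in>{n..}. ?D m) \<in> sets (lebesgue_on S)"
      by (intro sets.countable_INT') auto
    also have "(\<Inter>m\<in>{n..}. ?D m) = A n"
      by (auto simp: A_def)
    finally have "A n \<in> sets (lebesgue_on S)" .
    then show ?thesis using sets_restrict_space_iff[of S lebesgue] SL by simp
  qed
  show lm: "A n \<in> lmeasurable" for n
    by (rule fmeasurableI2[OF S _ sets]) (auto simp: A_def)
  have U: "(\<Union>n. A n) = S"
  proof -
    have "\<exists>n. \<forall>m\<ge>n. \<bar>f m s - l\<bar> < e" if "s \<in> S" for s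
      using LIMSEQ_D[OF lim[OF that] \<open>0 < e\<close>] by simp
    then show ?thesis by (auto simp: A_def)
  qed
  have "(\<lambda>n. measure lebesgue (A n)) \<longlonglongrightarrow> measure lebesgue (\<Union>n. A n)"
  proof (rule Lim_measure_incseq)
    show "incseq A" by (auto simp: A_def incseq_def)
    show "emeasure lebesgue (\<Union>n. A n) \<noteq> \<infinity>"
      unfolding U infinity_ennreal_def using fmeasurableD2[OF S] .
  qed (use sets in auto)
  then show "(\<lambda>n. measure lebesgue (A n)) \<longlonglongrightarrow> measure lebesgue S"
    by (simp add: U)
qed

text \<open>Inner composition with an arbitrary measurable map can destroy Lebesgue measurability;
  scaling is harmless because it pulls Lebesgue sets back to Lebesgue sets.\<close>

lemma lebesgue_on_compose_scale:
  fixes L :: "real \<Rightarrow> real"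
  assumes "L \<in> borel_measurable (lebesgue_on T)" and "\<And>v. v \<in> S \<Longrightarrow> x * v \<in> T"
  shows "(\<lambda>v. L (x * v)) \<in> borel_measurable (lebesgue_on S)"
proof -
  have "(*) x \<in> lebesgue_on S \<rightarrow>\<^sub>M lebesgue_on T"
  proof (rule measurable_restrict_space3)
    have "(*) x = (*\<^sub>R) x" by (simp add: fun_eq_iff)
    then show "(*) x \<in> lebesgue \<rightarrow>\<^sub>M lebesgue" by simp
  qed (use assms(2) in auto)
  then show ?thesis
    using assms(1) by (rule measurable_compose)
qed

text \<open>A violating sequence \<open>u\<^sub>n x\<^sub>n\<close> is refuted by a point \<open>v = u\<^sub>n w\<close> at which both
  \<open>L(x\<^sub>n v) / L(x\<^sub>n)\<close> and \<open>L(x\<^sub>n u\<^sub>n w) / L(x\<^sub>n u\<^sub>n)\<close> are close to 1. It exists because the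
  admissible \<open>v\<close> and the admissible \<open>u\<^sub>n w\<close> both lie in \<open>[1, 4]\<close> and have total measure above 3.\<close>

lemma slowly_varying_doubling:
  assumes "slowly_varying L"
  shows "\<forall>\<^sub>F x in at_top. \<forall>u\<in>{1..2}. L (u * x) \<le> 2 * L x"
proof (rule ccontr)
  assume contra: "\<not> ?thesis"
  obtain x0 where x0: "x0 > 0" "\<And>x. x \<ge> x0 \<Longrightarrow> L x > 0"
    and meas: "L \<in> borel_measurable (lebesgue_on {x0..})"
    and lim: "\<And>c. c > 0 \<Longrightarrow> ((\<lambda>x. L (c * x) / L x) \<longlongrightarrow> 1) at_top"
    using assms by (auto simp: slowly_varying_def regularly_varying_def)
  have "\<exists>x u. x \<ge> max x0 (real n) \<and> u \<in> {1..2} \<and> L (u * x) > 2 * L x" for n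
    using contra unfolding eventually_at_top_linorder
    by (metis linorder_not_le)
  then obtain x u where xu: "\<And>n. x n \<ge> max x0 (real n)" "\<And>n. u n \<in> {1..2}"
    "\<And>n. L (u n * x n) > 2 * L (x n)"
    by metis
  have x_lim: "filterlim x at_top sequentially"
    using xu(1) by (intro filterlim_at_top_mono[OF filterlim_real_sequentially]) auto
  have ge: "x0 \<le> x n" "x0 \<le> x n * u n" for n
  proof -
    show *: "x0 \<le> x n" using xu(1)[of n] by simp
    have "x n * 1 \<le> x n * u n"
      using * x0 xu(2)[of n] by (intro mult_left_mono) auto
    then show "x0 \<le> x n * u n" using * by simp
  qed
  have xu_lim: "filterlim (\<lambda>n. x n * u n) at_top sequentially"
  proof (rule filterlim_at_top_mono[OF x_lim])
    have "x n * 1 \<le> x n * u n" for n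
      using ge[of n] x0 xu(2)[of n] by (intro mult_left_mono) auto
    then show "\<forall>\<^sub>F n in sequentially. x n \<le> x n * u n" by simp
  qed
  \<comment> \<open>\<open>V n\<close> gathers the dilations that are good for the base points
    \<open>x m\<close> with \<open>m \<ge> n\<close>, and \<open>W n\<close> those good for
    \<open>x m * u m\<close>. The interval \<open>{1..4}\<close> is where \<open>u n * w\<close>
    lands when both factors lie in \<open>{1..2}\<close>.\<close>
  define V where "V n = {v \<in> {1..4}. \<forall>m\<ge>n. \<bar>L (x m * v) / L (x m) - 1\<bar> < 1/4}" for n
  define W where "W n = {w \<in> {1..2}. \<forall>m\<ge>n. \<bar>L (x m * u m * w) / L (x m * u m) - 1\<bar> < 1/4}" for n
  have tail: "{v \<in> {1..b}. \<forall>m\<ge>n. \<bar>L (z m * v) / L (z m) - 1\<bar> < 1/4} \<in> lmeasurable \<and>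
      (\<lambda>n. measure lebesgue {v \<in> {1..b}. \<forall>m\<ge>n. \<bar>L (z m * v) / L (z m) - 1\<bar> < 1/4})
        \<longlonglongrightarrow> measure lebesgue {1..b}"
    if z: "\<And>n. x0 \<le> z n" "filterlim z at_top sequentially" for z n and b :: real
  proof -
    have *: "(\<lambda>v. L (z m * v) / L (z m)) \<in> borel_measurable (lebesgue_on {1..b})" for m
    proof -
      have "x0 \<le> z m * v" if "v \<in> {1..b}" for v
      using mult_mono[of x0 "z m" 1 v] z(1)[of m] that x0 by auto
      then show ?thesis
        by (intro borel_measurable_divide lebesgue_on_compose_scale[OF meas]) auto
    qed
    have "(\<lambda>m. L (z m * v) / L (z m)) \<longlonglongrightarrow> 1" if "v \<in> {1..b}" for v
      using filterlim_compose[OF lim[of v] z(2)] that by (simp add: mult.commute)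
    note lims = this
    have quarter: "0 < (1 / 4 :: real)" by simp
    note tails = tail_sets_measure_tendsto[OF lmeasurable_interval(1) * lims quarter]
    show ?thesis
      by (intro conjI tails)
  qed
  have interval: "measure lebesgue {1..4::real} = 3" "measure lebesgue {1..2::real} = 1"
    by simp_all
  have V: "V n \<in> lmeasurable" "(\<lambda>n. measure lebesgue (V n)) \<longlonglongrightarrow> 3" for n
    unfolding V_def interval(1)[symmetric] using tail[OF ge(1) x_lim, of 4] by blast+
  have W: "W n \<in> lmeasurable" "(\<lambda>n. measure lebesgue (W n)) \<longlonglongrightarrow> 1" for n
  proof -
    show "W n \<in> lmeasurable"
      unfolding W_def using tail[OF ge(2) xu_lim, of 2] by blast
    show "(\<lambda>n. measure lebesgue (W n)) \<longlonglongrightarrow> 1"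
      using tail[OF ge(2) xu_lim, of 2, THEN conjunct2] unfolding W_def interval(2) .
  qed
  have "\<forall>\<^sub>F n in sequentially. 5/2 < measure lebesgue (V n) \<and> 3/4 < measure lebesgue (W n)"
    using order_tendstoD(1)[OF V(2), of "5/2"] order_tendstoD(1)[OF W(2), of "3/4"]
    by (intro eventually_conj) simp_all
  \<comment> \<open>The sum 5/2 + 3/4 exceeds 3, the length of \<open>{1..4}\<close>. Scaling
    \<open>W n\<close> by \<open>u n \<ge> 1\<close> does not shrink it, so an overlap is forced
    below.\<close>
  then obtain n where n: "5/2 < measure lebesgue (V n)" "3/4 < measure lebesgue (W n)"
    using eventually_happens'[OF sequentially_bot] by blast
  define W' where "W' = (*) (u n) ` W n"
  have un: "1 \<le> u n" "u n \<le> 2" using xu(2)[of n] by auto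
  have W'_sub: "W' \<subseteq> {1..4}"
  proof -
    have "1 \<le> u n * w \<and> u n * w \<le> 4" if "w \<in> {1..2}" for w
      using mult_mono[of 1 "u n" 1 w] mult_mono[of "u n" 2 w 2] that un by auto
    then show ?thesis by (auto simp: W'_def W_def)
  qed
  have "W' = (*\<^sub>R) (1 / u n) -` W n"
    using un by (force simp: W'_def image_iff)
  \<comment> \<open>The image is measurable because it is a preimage under the inverse
    scaling.\<close>
  then have W'_sets: "W' \<in> sets lebesgue"
    using measurable_sets[OF lebesgue_measurable_scaling[of "1 / u n"], of "W n"] W(1)[of n] by auto
  have W'_lm: "W' \<in> lmeasurable"
    by (rule fmeasurableI2[OF _ W'_sub W'_sets]) auto
  have "measure lebesgue W' = u n * measure lebesgue (W n)"
    using measure_lebesgue_affine[of "u n" 0 "W n"] un by (simp add: W'_def)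
  also have "\<dots> \<ge> 1 * measure lebesgue (W n)"
    using un by (intro mult_right_mono) auto
  finally have W'_meas: "3/4 < measure lebesgue W'" using n by simp
  have "V n \<inter> W' \<noteq> {}"
  proof
    assume "V n \<inter> W' = {}"
    then have "measure lebesgue (V n \<union> W') = measure lebesgue (V n) + measure lebesgue W'"
      using measure_Un3[OF V(1)[of n] W'_lm] by simp
    moreover have "measure lebesgue (V n \<union> W') \<le> measure lebesgue {1..4::real}"
    proof (rule measure_mono_fmeasurable)
      show "V n \<union> W' \<subseteq> {1..4}" using W'_sub by (auto simp: V_def)
      show "V n \<union> W' \<in> sets lebesgue" using fmeasurableD[OF V(1)[of n]] W'_sets by (rule sets.Un)
    qed simp
    ultimately show False using n W'_meas unfolding interval by linarith
  qed
  then obtain w where w: "w \<in> W n" "u n * w \<in> V n" unfolding W'_def by blast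
  have pos: "0 < L (x n)" "0 < L (x n * u n)" using ge x0(2) by auto
  have "L (x n * u n * w) / L (x n) < 5/4" "3/4 < L (x n * u n * w) / L (x n * u n)"
  proof -
    have "\<bar>L (x n * u n * w) / L (x n) - 1\<bar> < 1/4"
      using w(2) unfolding V_def mult.assoc by blast
    then show "L (x n * u n * w) / L (x n) < 5/4" by linarith
    have "\<bar>L (x n * u n * w) / L (x n * u n) - 1\<bar> < 1/4"
      using w(1) unfolding W_def by blast
    then show "3/4 < L (x n * u n * w) / L (x n * u n)" by linarith
  qed
  then have "L (x n * u n * w) < 5/4 * L (x n)" "3/4 * L (x n * u n) < L (x n * u n * w)"
    using pos by (metis pos_divide_less_eq, metis pos_less_divide_eq)
  moreover have "2 * L (x n) < L (x n * u n)"
    using xu(3)[of n] by (simp only: mult.commute)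
  \<comment> \<open>Chaining the bounds puts \<open>L (x n * u n)\<close> below 4/3 times 5/4, that
    is 5/3, of \<open>L (x n)\<close>, against the assumed factor 2.\<close>
  ultimately show False
    using pos by linarith
qed

text \<open>Halving \<open>y\<close> until it is at most \<open>2 * X\<close> costs a factor 2 per
  step; the last step uses the dilation \<open>y / X\<close>, which lies in
  \<open>{1..2}\<close>.\<close>

lemma doubling_imp_bounded:
  fixes L :: "real \<Rightarrow> real"
  assumes "0 < X" "0 < L X" and double: "\<And>x u. X \<le> x \<Longrightarrow> u \<in> {1..2} \<Longrightarrow> L (u * x) \<le> 2 * L x"
  shows "X \<le> y \<Longrightarrow> y \<le> 2 ^ n * X \<Longrightarrow> L y \<le> 2 ^ n * L X"
proof (induction n arbitrary: y)
  case 0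
  then show ?case by simp
next
  case (Suc n)
  show ?case
  proof (cases "y \<le> 2 * X")
    case True
    then have "L (y / X * X) \<le> 2 * L X"
      using \<open>X \<le> y\<close> \<open>0 < X\<close> by (intro double) (auto simp: field_simps)
    also have "\<dots> \<le> 2 ^ Suc n * L X"
      using \<open>0 < L X\<close> one_le_power[of "2::real" n] by simp
    finally show ?thesis using \<open>0 < X\<close> by simp
  next
    case False
    then have "L (2 * (y / 2)) \<le> 2 * L (y / 2)"
      by (intro double) auto
    moreover have "L (y / 2) \<le> 2 ^ n * L X"
      using Suc.prems False by (intro Suc.IH) auto
    ultimately show ?thesis by simp
  qed
qed

section \<open>Half-lines on which a slowly varying function is well behaved\<close>

text \<open>What slow variation provides once \<open>a\<close> is large. Positivity, measurability
  and the ratio limits are immediate; \<open>L_bdd\<close> comes from the doubling bound and serves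
  to bound the convolution kernel.\<close>

locale slowly_varying_tail =
  fixes L :: "real \<Rightarrow> real" and a :: real
  assumes a_pos: "0 < a"
    and L_pos: "\<And>x. a \<le> x \<Longrightarrow> 0 < L x"
    and L_meas: "L \<in> borel_measurable (lebesgue_on {a..})"
    and L_bdd: "\<And>b. \<exists>K. \<forall>x\<in>{a..b}. L x \<le> K"
    and L_ratio: "\<And>c. 0 < c \<Longrightarrow> ((\<lambda>x. L (c * x) / L x) \<longlongrightarrow> 1) at_top"

lemma eventually_slowly_varying_tail:
  assumes "slowly_varying L"
  shows "\<forall>\<^sub>F a in at_top. slowly_varying_tail L a"
proof -
  obtain x0 where x0: "x0 > 0" "\<And>x. x \<ge> x0 \<Longrightarrow> L x > 0"
    and meas: "L \<in> borel_measurable (lebesgue_on {x0..})"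
    and lim: "\<And>c. c > 0 \<Longrightarrow> ((\<lambda>x. L (c * x) / L x) \<longlongrightarrow> 1) at_top"
    using assms by (auto simp: slowly_varying_def regularly_varying_def)
  obtain X1 where X1: "\<And>x u. X1 \<le> x \<Longrightarrow> u \<in> {1..2} \<Longrightarrow> L (u * x) \<le> 2 * L x"
    using slowly_varying_doubling[OF assms] unfolding eventually_at_top_linorder by metis
  have "slowly_varying_tail L a" if a: "a \<ge> max x0 X1" for a
  proof
    fix b
    have a0: "0 < a" using a x0 by simp
    obtain n :: nat where "b / a < 2 ^ n"
      using real_arch_pow[of 2 "b / a"] by auto
    then have "b \<le> 2 ^ n * a" using a0 by (simp add: field_simps)
    then show "\<exists>K. \<forall>x\<in>{a..b}. L x \<le> K"
      using doubling_imp_bounded[of a L _ n] X1 a a0 x0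
      by (intro exI[of _ "2 ^ n * L a"]) auto
  next
    show "L \<in> borel_measurable (lebesgue_on {a..})"
      using a by (intro measurable_restrict_mono[OF meas]) auto
  qed (use a x0 lim in auto)
  then show ?thesis unfolding eventually_at_top_linorder by blast
qed

section \<open>Integrability, measurability and positivity of the convolution\<close>

text \<open>Extended by 0 off \<open>S\<close>, a Lebesgue measurable function agrees almost
  everywhere with a Borel one. The Borel version can be composed with \<open>x / u\<close> and
  treated jointly in \<open>x\<close> and \<open>u\<close>.\<close>

lemma lebesgue_on_borel_representative:
  fixes f :: "real \<Rightarrow> real"
  assumes "f \<in> borel_measurable (lebesgue_on S)" "S \<in> sets lebesgue"
  obtains g N where "g \<in> borel_measurable borel" "negligible N" "\<And>x. x \<in> S - N \<Longrightarrow> f x = g x"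
proof -
  obtain g where g: "g \<in> borel_measurable lborel" "AE x in lborel. (if x \<in> S then f x else 0) = g x"
    using completion_ex_borel_measurable_real[OF borel_measurable_if_I[OF assms]] by blast
  obtain N where N: "{x \<in> space lborel. (if x \<in> S then f x else 0) \<noteq> g x} \<subseteq> N"
    "emeasure lborel N = 0" "N \<in> sets lborel"
    using g(2) by (rule AE_E)
  have "N \<in> null_sets lebesgue"
    using N by (auto intro: null_sets_completionI)
  moreover have "f x = g x" if "x \<in> S - N" for x
  proof -
    have "(if x \<in> S then f x else 0) = g x" using N(1) that by (auto split: if_splits)
    then show ?thesis using that by simp
  qed
  ultimately show thesis
    using that g(1) by (simp add: negligible_iff_null_sets)
qed

context slowly_varying_tail
begin

abbreviation kern :: "real \<Rightarrow> real \<Rightarrow> real" where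
  "kern x u \<equiv> L u * L (x / u) / u"

lemma arg_in_range: "u \<in> {a..x/a} \<Longrightarrow> 0 < u \<and> a \<le> x / u \<and> x / u \<le> x / a \<and> 0 < x"
proof -
  assume u: "u \<in> {a..x/a}"
  then have "0 < u" "a * u \<le> x" using a_pos by (auto simp: field_simps)
  moreover from this have "0 < x" using a_pos by (smt (verit) mult_pos_pos)
  ultimately show ?thesis using u a_pos by (auto simp: field_simps)
qed

lemma kern_pos: "u \<in> {a..x/a} \<Longrightarrow> 0 < kern x u"
  using arg_in_range[of u x] by (auto intro!: divide_pos_pos mult_pos_pos L_pos)

text \<open>Composition of Lebesgue measurable functions is not measurable in general; here it works
  because \<open>u \<mapsto> x / u\<close> preserves null sets.\<close>

lemma kern_borel_representative:
  obtains g where "g \<in> borel_measurable borel"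
    and "\<forall>x. \<exists>N. negligible N \<and> (\<forall>u \<in> {a..x/a} - N. kern x u = g u * g (x / u) / u)"
proof -
  obtain g N where g: "g \<in> borel_measurable borel" and N: "negligible N"
    and eq: "\<And>x. x \<in> {a..} - N \<Longrightarrow> L x = g x"
    using lebesgue_on_borel_representative[OF L_meas] by auto
  have "\<exists>N. negligible N \<and> (\<forall>u \<in> {a..x/a} - N. kern x u = g u * g (x / u) / u)" for x
  proof (intro exI conjI ballI)
    \<comment> \<open>\<open>?M\<close> catches the \<open>u\<close> in the range with
      \<open>x / u\<close> in \<open>N\<close>, since the map is its own inverse there. Restricting
      to \<open>{a..}\<close> avoids the singularity at 0, so the map is differentiable and sends
      null sets to null sets.\<close>
    let ?M = "(\<lambda>y. x / y) ` (N \<inter> {a..})"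
    have "(\<lambda>y. x / y) differentiable_on N \<inter> {a..}"
      using a_pos by (auto simp: differentiable_on_def intro!: derivative_intros differentiable_divide)
    then have "negligible ?M"
      using negligible_subset[OF N, of "N \<inter> {a..}"]
      by (intro negligible_differentiable_image_negligible) auto
    then show "negligible (N \<union> ?M)" using N by simp
    fix u assume u: "u \<in> {a..x/a} - (N \<union> ?M)"
    then have u': "0 < u" "a \<le> x / u" "0 < x" using arg_in_range[of u x] by auto
    have "x / u \<notin> N"
    proof
      assume "x / u \<in> N"
      then have "x / (x / u) \<in> ?M" using u' by (intro imageI) auto
      then show False using u u' by simp
    qed
    then show "kern x u = g u * g (x / u) / u"
      using eq[of u] eq[of "x / u"] u u' by auto
  qed
  then show thesis using that g by blast
qed

text \<open>Both arguments of \<open>L\<close> stay in \<open>{a..x/a}\<close>, where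
  \<open>L\<close> has an upper bound \<open>K\<close>; hence the kernel is at most
  \<open>K * K / a\<close>. Its measurability comes from the Borel representative.\<close>

lemma kern_absolutely_integrable: "kern x absolutely_integrable_on {a..x/a}"
proof -
  obtain g where g: "g \<in> borel_measurable borel"
    and ex: "\<forall>x. \<exists>N. negligible N \<and> (\<forall>u \<in> {a..x/a} - N. kern x u = g u * g (x / u) / u)"
    using kern_borel_representative by blast
  obtain N where N: "negligible N" and "\<forall>u \<in> {a..x/a} - N. kern x u = g u * g (x / u) / u"
    using spec[OF ex, of x] by blast
  then have eq: "\<And>u. u \<in> {a..x/a} - N \<Longrightarrow> kern x u = g u * g (x / u) / u"
    by (elim bspec)
  have "(\<lambda>u. if u \<in> {a..x/a} then g u * g (x / u) / u else 0) \<in> borel_measurable borel"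
    using g by measurable
  then have "(\<lambda>u. if u \<in> {a..x/a} then g u * g (x / u) / u else 0) \<in> borel_measurable lebesgue"
    by (intro measurable_completion) simp
  moreover have "AE u in lebesgue. (if u \<in> {a..x/a} then g u * g (x / u) / u else 0)
      = (if u \<in> {a..x/a} then kern x u else 0)"
  proof (rule AE_I')
    show "N \<in> null_sets lebesgue" using N by (simp add: negligible_iff_null_sets)
    show "{u \<in> space lebesgue. (if u \<in> {a..x/a} then g u * g (x / u) / u else 0)
        \<noteq> (if u \<in> {a..x/a} then kern x u else 0)} \<subseteq> N"
    proof (intro subsetI, rule ccontr)
      fix u assume "u \<in> {u \<in> space lebesgue. (if u \<in> {a..x/a} then g u * g (x / u) / u else 0)
        \<noteq> (if u \<in> {a..x/a} then kern x u else 0)}" "u \<notin> N"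
      then show False using eq[of u] by (auto split: if_splits)
    qed
  qed
  ultimately have "(\<lambda>u. if u \<in> {a..x/a} then kern x u else 0) \<in> borel_measurable lebesgue"
    by (rule borel_measurable_AE)
  then have meas: "kern x \<in> borel_measurable (lebesgue_on {a..x/a})"
    by (subst borel_measurable_if[symmetric]) auto
  obtain K where K: "\<And>y. y \<in> {a..x/a} \<Longrightarrow> L y \<le> K" using L_bdd by blast
  show ?thesis
  proof (rule measurable_bounded_by_integrable_imp_absolutely_integrable[OF meas])
    fix u assume u: "u \<in> {a..x/a}"
    note r = arg_in_range[OF u]
    have "L u * L (x / u) \<le> K * K"
      using K u r L_pos[of u] L_pos[of "x / u"] by (intro mult_mono) (auto intro: less_imp_le order_trans)
    then have "kern x u \<le> K * K / a"
      using u a_pos r L_pos[of u] L_pos[of "x / u"] by (intro frac_le) auto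
    then show "norm (kern x u) \<le> K * K / a" using kern_pos[OF u] by simp
  qed auto
qed

lemma kern_integrable: "a \<le> p \<Longrightarrow> q \<le> x / a \<Longrightarrow> kern x integrable_on {p..q}"
  using set_lebesgue_integral_eq_integral(1)[OF kern_absolutely_integrable]
  by (rule integrable_subinterval_real) auto

lemma mult_conv_eq_integral: "mult_conv a L x = integral {a..x/a} (kern x)"
  unfolding mult_conv_def
  by (rule set_lebesgue_integral_eq_integral(2)[OF kern_absolutely_integrable])

text \<open>The exceptional null set depends on \<open>x\<close>, but the representative
  \<open>g\<close> does not. Replacing \<open>L\<close> by \<open>g\<close> therefore changes no
  value of the convolution, and the new integrand is jointly Borel, so integrating out
  \<open>u\<close> leaves a Borel function of \<open>x\<close>.\<close>

lemma mult_conv_borel_measurable: "mult_conv a L \<in> borel_measurable borel"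
proof -
  obtain g where g: "g \<in> borel_measurable borel"
    and ex: "\<forall>x. \<exists>N. negligible N \<and> (\<forall>u \<in> {a..x/a} - N. kern x u = g u * g (x / u) / u)"
    using kern_borel_representative by blast
  have "mult_conv a L = (\<lambda>x. LINT u|lborel. indicator {a..x/a} u *\<^sub>R (g u * g (x / u) / u))"
  proof
    fix x
    obtain N where N: "negligible N" and "\<forall>u \<in> {a..x/a} - N. kern x u = g u * g (x / u) / u"
      using spec[OF ex, of x] by blast
    then have eq: "\<And>u. u \<in> {a..x/a} - N \<Longrightarrow> kern x u = g u * g (x / u) / u"
      by (elim bspec)
    have abs: "(\<lambda>u. g u * g (x / u) / u) absolutely_integrable_on {a..x/a}"
      using kern_absolutely_integrable N by (rule absolutely_integrable_spike) (simp add: eq)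
    have "mult_conv a L x = integral {a..x/a} (\<lambda>u. g u * g (x / u) / u)"
      unfolding mult_conv_eq_integral using N by (rule integral_spike) (simp add: eq)
    also have "\<dots> = (LINT u|lebesgue. indicator {a..x/a} u *\<^sub>R (g u * g (x / u) / u))"
      using set_lebesgue_integral_eq_integral(2)[OF abs] by (simp add: set_lebesgue_integral_def)
    also have "\<dots> = (LINT u|lborel. indicator {a..x/a} u *\<^sub>R (g u * g (x / u) / u))"
    proof (rule integral_completion)
      have "(\<lambda>u. indicator {a..x/a} u *\<^sub>R (g u * g (x / u) / u)) \<in> borel_measurable borel"
        using g by measurable
      then show "(\<lambda>u. indicator {a..x/a} u *\<^sub>R (g u * g (x / u) / u)) \<in> borel_measurable lborel"
        by simp
    qed
    finally show "mult_conv a L x = (LINT u|lborel. indicator {a..x/a} u *\<^sub>R (g u * g (x / u) / u))" .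
  qed
  moreover have "(\<lambda>x. LINT u|lborel. indicator {a..x/a} u *\<^sub>R (g u * g (x / u) / u)) \<in> borel_measurable borel"
  proof (rule lborel.borel_measurable_lebesgue_integral)
    \<comment> \<open>Written with inequalities, the moving interval becomes a jointly measurable
      condition on the pair.\<close>
    have ind: "indicator {a..x/a} u = (if a \<le> u \<and> u \<le> x / a then 1 else (0::real))" for x u
      by (simp add: indicator_def)
    have "(\<lambda>(x, u). (if a \<le> u \<and> u \<le> x / a then 1 else (0::real)) *\<^sub>R (g u * g (x / u) / u))
        \<in> borel_measurable (borel \<Otimes>\<^sub>M borel)"
      using g by measurable
    moreover have "sets (borel \<Otimes>\<^sub>M lborel :: (real \<times> real) measure) = sets (borel \<Otimes>\<^sub>M borel)"
      by (intro sets_pair_measure_cong) simp_all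
    ultimately show "(\<lambda>(x, u). indicator {a..x/a} u *\<^sub>R (g u * g (x / u) / u))
        \<in> borel_measurable (borel \<Otimes>\<^sub>M lborel)"
      unfolding ind by (subst measurable_cong_sets[OF _ refl])
  qed
  ultimately show ?thesis by simp
qed

text \<open>A vanishing integral of the positive kernel would make \<open>{a..x/a}\<close> null,
  although its interior is nonempty.\<close>

lemma mult_conv_pos: "a\<^sup>2 < x \<Longrightarrow> 0 < mult_conv a L x"
proof -
  assume x: "a\<^sup>2 < x"
  let ?S = "{a..x/a}"
  have nonneg: "\<forall>u\<in>?S. 0 \<le> kern x u" using kern_pos by (auto intro: less_imp_le)
  have "mult_conv a L x \<noteq> 0"
  proof
    assume "mult_conv a L x = 0"
    then have "(LINT u|lebesgue. indicator ?S u *\<^sub>R kern x u) = 0"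
      by (simp add: mult_conv_def set_lebesgue_integral_def)
    moreover have "integrable lebesgue (\<lambda>u. indicator ?S u *\<^sub>R kern x u)"
      using kern_absolutely_integrable by (simp add: set_integrable_def)
    moreover have "AE u in lebesgue. 0 \<le> indicator ?S u *\<^sub>R kern x u"
      using nonneg by (intro AE_I2) (simp add: indicator_def)
    ultimately have "AE u in lebesgue. indicator ?S u *\<^sub>R kern x u = 0"
      by (simp only: integral_nonneg_eq_0_iff_AE)
    then have "AE u in lebesgue. u \<notin> ?S"
      by eventually_elim (use kern_pos in \<open>force simp: indicator_def\<close>)
    then have "?S \<in> null_sets lebesgue" by (subst AE_iff_null_sets) auto
    then have "negligible (cbox a (x/a))" by (simp add: negligible_iff_null_sets)
    then have "box a (x/a) = {}" by (simp only: negligible_interval)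
    then show False using x a_pos by (simp add: field_simps power2_eq_square)
  qed
  moreover have "0 \<le> integral ?S (kern x)"
    using kern_integrable nonneg by (intro integral_nonneg) auto
  ultimately show ?thesis by (simp add: mult_conv_eq_integral)
qed

section \<open>Multiplicative substitution and one-factor estimates\<close>

text \<open>Substitution \<open>u = c * v\<close>: since du/u is invariant under dilation, the
  factor \<open>c\<close> cancels and the denominator is \<open>v\<close>.\<close>

lemma kern_scale:
  assumes "0 < c" "a \<le> c * p" "c * q \<le> x / a"
  shows "((\<lambda>v. L (c * v) * L (x / (c * v)) / v) has_integral integral {c*p..c*q} (kern x)) {p..q}"
proof -
  have "(kern x has_integral integral {c*p..c*q} (kern x)) (cbox (c*p) (c*q))"
    using kern_integrable[OF assms(2,3)] by (simp add: integrable_integral)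
  from has_integral_affinity'[OF this \<open>0 < c\<close>, of 0]
  have "((\<lambda>v. kern x (c * v)) has_integral integral {c*p..c*q} (kern x) / c) {p..q}"
    using \<open>0 < c\<close> by (simp add: field_simps)
  from has_integral_mult_right[OF this, of c] show ?thesis
    using \<open>0 < c\<close> by simp
qed

lemma L_ratio_bounds:
  assumes "0 < c" "0 < e"
  obtains Y where "a \<le> Y" "\<And>y. Y \<le> y \<Longrightarrow> (1 - e) * L y \<le> L (c * y) \<and> L (c * y) \<le> (1 + e) * L y"
proof -
  have "\<forall>\<^sub>F y in at_top. dist (L (c * y) / L y) 1 < e"
    using tendstoD[OF L_ratio[OF \<open>0 < c\<close>] \<open>0 < e\<close>] .
  then obtain Y where Y: "\<And>y. Y \<le> y \<Longrightarrow> \<bar>L (c * y) / L y - 1\<bar> < e"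
    by (auto simp: eventually_at_top_linorder dist_real_def)
  have "(1 - e) * L y \<le> L (c * y) \<and> L (c * y) \<le> (1 + e) * L y" if "max a Y \<le> y" for y
  proof -
    have pos: "0 < L y" using that L_pos by simp
    have "1 - e \<le> L (c * y) / L y" "L (c * y) / L y \<le> 1 + e"
      using Y[of y] that by auto
    then show ?thesis using pos by (simp add: pos_le_divide_eq pos_divide_le_eq)
  qed
  then show thesis using that[of "max a Y"] by auto
qed

lemma eventually_sqrt_ge: "\<forall>\<^sub>F x in at_top. K \<le> sqrt x"
  using sqrt_at_top by (simp add: filterlim_at_top)

lemma sqrt_in_range:
  assumes "a \<le> sqrt x"
  shows "0 < x" "sqrt x \<le> x / a" "\<And>u. 0 < u \<Longrightarrow> u \<le> sqrt x \<Longrightarrow> sqrt x \<le> x / u"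
proof -
  have s: "0 < sqrt x" using assms a_pos by linarith
  then show "0 < x" by simp
  then have sq: "sqrt x * sqrt x = x" by simp
  show *: "sqrt x \<le> x / u" if "0 < u" "u \<le> sqrt x" for u
    using mult_left_mono[OF that(2), of "sqrt x"] s sq that by (simp add: pos_le_divide_eq)
  show "sqrt x \<le> x / a" using *[OF a_pos assms] .
qed

lemma kern_integral_nonneg: "a \<le> p \<Longrightarrow> q \<le> x / a \<Longrightarrow> 0 \<le> integral {p..q} (kern x)"
  using kern_pos[of _ x] by (intro integral_nonneg kern_integrable) (auto intro!: less_imp_le)

section \<open>The block just below the square root is negligible\<close>

text \<open>Substituting \<open>u = v / d\<close> carries the shifted block to the block of all
  \<open>v\<close> between \<open>sqrt x / c\<close> and \<open>sqrt x\<close>. There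
  \<open>v / d\<close> and \<open>x / v\<close> are both uniformly large, so the ratio limit at the
  single factor \<open>d\<close> compares both factors of the kernel.\<close>

lemma shifted_block_lower_bound:
  assumes "1 \<le> c" "1 \<le> d"
  shows "\<forall>\<^sub>F x in at_top. integral {sqrt x / c..sqrt x} (kern x) / 2
           \<le> integral {sqrt x / (c * d)..sqrt x / d} (kern x)"
proof -
  \<comment> \<open>Tolerance 1/3 yields the factor 3/4 for \<open>L (v / d)\<close>, by inverting
    the upper bound at \<open>v / d\<close>, and 2/3 for \<open>L (d * (x / v))\<close>; their
    product is 1/2.\<close>
  obtain Y where Y: "a \<le> Y"
    "\<And>y. Y \<le> y \<Longrightarrow> (1 - 1/3) * L y \<le> L (d * y) \<and> L (d * y) \<le> (1 + 1/3) * L y"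
    using L_ratio_bounds[of d "1/3"] assms by auto
  have "integral {sqrt x / c..sqrt x} (kern x) / 2 \<le> integral {sqrt x / (c * d)..sqrt x / d} (kern x)"
    if x: "c * d * Y \<le> sqrt x" for x
  proof -
    define s where "s = sqrt x"
    have Y0: "0 < Y" using Y(1) a_pos by simp
    have cd: "1 \<le> c * d" using assms mult_mono[of 1 c 1 d] by simp
    have "1 * Y \<le> c * d * Y" using cd Y0 by (intro mult_right_mono) auto
    then have sY: "Y \<le> s" using x by (simp add: s_def)
    then have s: "a \<le> sqrt x" "0 < s" using Y(1) Y0 unfolding s_def by linarith+
    note r = sqrt_in_range[OF s(1), folded s_def]
    \<comment> \<open>The threshold \<open>c * d * Y\<close> is chosen for this: every
      \<open>v\<close> in the block has \<open>v / d\<close> at least \<open>Y\<close>.\<close>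
    have scd: "Y \<le> s / c / d" using x cd assms by (simp add: field_simps s_def)
    have "s / c / d \<le> s / c" using assms s by (simp add: field_simps)
    then have sc: "a \<le> s / c" using scd Y by linarith
    have "s / d \<le> s" using assms s by (simp add: field_simps)
    then have sd: "1 / d * s \<le> x / a" using r(2) by simp
    have int: "((\<lambda>v. L (1 / d * v) * L (x / (1 / d * v)) / v)
        has_integral integral {1 / d * (s / c)..1 / d * s} (kern x)) {s / c..s}"
    proof (intro kern_scale)
      show "a \<le> 1 / d * (s / c)" using scd Y(1) by (simp add: mult.commute)
    qed (use sd assms in auto)
    have int': "((\<lambda>v. kern x v / 2) has_integral integral {s / c..s} (kern x) / 2) {s / c..s}"
      using kern_integrable[OF sc r(2)] by (intro has_integral_divide) (simp add: integrable_integral)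
    have "integral {s / c..s} (kern x) / 2 \<le> integral {1 / d * (s / c)..1 / d * s} (kern x)"
    proof (rule has_integral_le[OF int' int])
      fix v assume v: "v \<in> {s / c..s}"
      then have v0: "0 < v" "a \<le> v" using sc a_pos by auto
      have "s / c / d \<le> v / d" using v assms by (intro divide_right_mono) auto
      then have "Y \<le> v / d" using scd by linarith
      from Y(2)[OF this] have 1: "3/4 * L v \<le> L (v / d)" using assms by simp
      have xv: "s \<le> x / v" using r(3) v v0 by auto
      then have 2: "2/3 * L (x / v) \<le> L (d * (x / v))" using Y(2)[of "x / v"] sY by simp
      have "(3/4 * L v) * (2/3 * L (x / v)) \<le> L (v / d) * L (d * (x / v))"
        using 1 2 v0 xv sY Y(1) L_pos[of v] L_pos[of "x / v"] by (intro mult_mono) auto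
      then have "L v * L (x / v) / 2 \<le> L (v / d) * L (d * (x / v))" by simp
      then have "L v * L (x / v) / 2 / v \<le> L (v / d) * L (d * (x / v)) / v"
        using v0 by (intro divide_right_mono) auto
      then show "kern x v / 2 \<le> L (1 / d * v) * L (x / (1 / d * v)) / v"
        by (simp add: mult.commute)
    qed
    then show ?thesis by (simp add: s_def mult.commute)
  qed
  then show ?thesis
    using eventually_sqrt_ge[of "c * d * Y"] by (auto elim: eventually_mono)
qed

lemma sum_blocks:
  assumes "1 \<le> c" "a \<le> s / c ^ n" "s \<le> x / a" "0 < s"
  shows "(\<Sum>k<n. integral {s / c ^ Suc k..s / c ^ k} (kern x)) = integral {s / c ^ n..s} (kern x)"
  using assms(2)
proof (induction n)
  case 0
  then show ?case by simp
next
  case (Suc n)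
  have le: "s / c ^ Suc n \<le> s / c ^ n" "s / c ^ n \<le> s"
    using assms power_increasing[of n "Suc n" c] one_le_power[of c n]
    by (auto intro!: divide_left_mono simp: divide_le_eq)
  then have "a \<le> s / c ^ n" using Suc.prems by linarith
  with Suc.IH show ?case
    using Henstock_Kurzweil_Integration.integral_combine[OF le kern_integrable[OF Suc.prems assms(3)]]
    by simp
qed

lemma middle_block_negligible:
  assumes "1 < c" "0 < e"
  shows "\<forall>\<^sub>F x in at_top. integral {sqrt x / c..sqrt x} (kern x) \<le> e * mult_conv a L x"
proof -
  \<comment> \<open>With \<open>n\<close> adjacent blocks, each contributing at least half of the
    top one, the top block is at most \<open>2 / n\<close> times the convolution. As
    \<open>n\<close> is fixed before \<open>x\<close>, finitely many eventual bounds
    suffice.\<close>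
  obtain n :: nat where n: "2 / e < real n" using reals_Archimedean2 by blast
  have "\<forall>\<^sub>F x in at_top. \<forall>k\<in>{..<n}. integral {sqrt x / c..sqrt x} (kern x) / 2
      \<le> integral {sqrt x / (c * c ^ k)..sqrt x / c ^ k} (kern x)"
    using assms by (intro eventually_ball_finite ballI shifted_block_lower_bound) auto
  moreover have "\<forall>\<^sub>F x in at_top. a * c ^ n \<le> sqrt x" by (rule eventually_sqrt_ge)
  ultimately show ?thesis
  proof eventually_elim
    case (elim x)
    define s J where "s = sqrt x" and "J = integral {s / c..s} (kern x)"
    have cn: "1 \<le> c ^ n" using assms by (intro one_le_power) auto
    have sn: "a \<le> s / c ^ n" using elim cn by (simp add: s_def pos_le_divide_eq)
    have "a * 1 \<le> a * c ^ n" using cn a_pos by (intro mult_left_mono) auto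
    then have s: "a \<le> sqrt x" using elim by linarith
    note r = sqrt_in_range[OF s, folded s_def]
    have s0: "0 < s" using s a_pos unfolding s_def by linarith
    have "real n * (J / 2) = (\<Sum>k<n. J / 2)" by simp
    also have "\<dots> \<le> (\<Sum>k<n. integral {s / c ^ Suc k..s / c ^ k} (kern x))"
      using elim by (intro sum_mono) (simp add: J_def s_def)
    also have "\<dots> = integral {s / c ^ n..s} (kern x)"
      using assms sn r(2) s0 by (intro sum_blocks) auto
    also have "\<dots> \<le> mult_conv a L x"
      unfolding mult_conv_eq_integral
      using sn r(2) kern_pos[of _ x]
      by (intro integral_subset_le kern_integrable) (auto intro!: less_imp_le)
    finally have 1: "real n * (J / 2) \<le> mult_conv a L x" .
    \<comment> \<open>Nonnegativity of \<open>J\<close> needs its block to start at or beyond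
      \<open>a\<close>; the alternative \<open>n = 0\<close> is excluded next.\<close>
    have "s / c \<ge> a \<or> n = 0"
    proof (cases n)
      case (Suc m)
      have "s / c ^ n \<le> s / c ^ 1"
        using assms s0 Suc by (intro divide_left_mono power_increasing) auto
      then show ?thesis using sn by simp
    qed simp
    moreover have "n \<noteq> 0"
    proof -
      have "0 < 2 / e" using assms by simp
      then have "0 < real n" using n by linarith
      then show ?thesis by simp
    qed
    ultimately have "0 \<le> J"
      using kern_integral_nonneg[of "s / c" s x] r(2) by (auto simp: J_def)
    moreover have "2 \<le> e * real n" using n assms by (simp add: field_simps)
    ultimately have "2 * (J / 2) \<le> (e * real n) * (J / 2)"
      by (intro mult_right_mono) auto
    also have "\<dots> \<le> e * mult_conv a L x"
      using mult_left_mono[OF 1, of e] assms by (simp add: mult.assoc)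
    finally show ?case by (simp add: J_def s_def)
  qed
qed

section \<open>Behaviour of the convolution under dilation\<close>

text \<open>The integral at \<open>c * x\<close> is cut at \<open>sqrt x\<close>. The lower piece is
  compared with the kernel for \<open>x\<close> up to \<open>sqrt x\<close>, the upper one, after
  \<open>u = c * v\<close>, with that kernel from \<open>sqrt x / c\<close> on. These two ranges
  overlap, which produces the extra integral.\<close>

lemma mult_conv_scaled_bounds:
  assumes "1 < c" "0 < e"
  shows "\<forall>\<^sub>F x in at_top.
    (1 - e) * (mult_conv a L x + integral {sqrt x / c..sqrt x} (kern x)) \<le> mult_conv a L (c * x) \<and>
    mult_conv a L (c * x) \<le> (1 + e) * (mult_conv a L x + integral {sqrt x / c..sqrt x} (kern x))"
proof -
  obtain Y where Y: "a \<le> Y"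
    "\<And>y. Y \<le> y \<Longrightarrow> (1 - e) * L y \<le> L (c * y) \<and> L (c * y) \<le> (1 + e) * L y"
    using L_ratio_bounds[of c e] assms by auto
  show ?thesis
    using eventually_sqrt_ge[of "c * Y"]
  proof eventually_elim
    case (elim x)
    define s where "s = sqrt x"
    have Y0: "0 < Y" using Y(1) a_pos by simp
    have "1 * Y \<le> c * Y" using Y0 assms by (intro mult_right_mono) auto
    then have sY: "Y \<le> s" using elim by (simp add: s_def)
    then have s: "a \<le> sqrt x" "0 < s" using Y(1) Y0 unfolding s_def by linarith+
    note r = sqrt_in_range[OF s(1), folded s_def]
    have sc: "Y \<le> s / c" using elim assms by (simp add: field_simps s_def)
    have scs: "s / c \<le> s" using assms s by (simp add: field_simps)
    have "1 * (x / a) \<le> c * (x / a)" using assms r(1) a_pos by (intro mult_right_mono) auto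
    then have xcx: "x / a \<le> c * x / a" by simp
    define A where "A = integral {a..s} (kern x)"
    define B where "B = integral {s / c..x / a} (kern x)"
    have iA: "(kern x has_integral A) {a..s}"
      unfolding A_def using r(2) by (intro integrable_integral kern_integrable) auto
    have iB: "(kern x has_integral B) {s / c..x / a}"
      unfolding B_def using sc Y(1) by (intro integrable_integral kern_integrable) auto
    have iA': "(kern (c * x) has_integral integral {a..s} (kern (c * x))) {a..s}"
      using r(2) xcx by (intro integrable_integral kern_integrable) auto
    have iB': "((\<lambda>v. L (c * v) * L (c * x / (c * v)) / v)
        has_integral integral {c * (s / c)..c * (x / a)} (kern (c * x))) {s / c..x / a}"
      using assms s by (intro kern_scale) (auto simp: s_def)
    \<comment> \<open>On the lower piece \<open>x / u\<close> is large, and only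
      \<open>L (c * x / u)\<close> has to be replaced.\<close>
    have bA: "(1 - e) * kern x u \<le> kern (c * x) u \<and> kern (c * x) u \<le> (1 + e) * kern x u"
      if u: "u \<in> {a..s}" for u
    proof -
      have u0: "0 < u" using u a_pos by auto
      then have "Y \<le> x / u" using r(3)[of u] u sY by auto
      note y = Y(2)[OF this]
      have "0 \<le> L u / u" using u u0 L_pos[of u] by (intro divide_nonneg_pos) auto
      from mult_left_mono[OF y[THEN conjunct1] this] mult_left_mono[OF y[THEN conjunct2] this]
      show ?thesis by (simp add: mult_ac)
    qed
    \<comment> \<open>Here \<open>c\<close> cancels in the second argument, so
      \<open>L (x / v)\<close> is untouched, and \<open>v\<close> itself is large.\<close>
    have bB: "(1 - e) * kern x v \<le> L (c * v) * L (c * x / (c * v)) / v \<and>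
        L (c * v) * L (c * x / (c * v)) / v \<le> (1 + e) * kern x v"
      if v: "v \<in> {s / c..x / a}" for v
    proof -
      have "v \<in> {a..x/a}" "Y \<le> v" using v sc Y(1) by auto
      note v' = arg_in_range[OF this(1)] and y = Y(2)[OF this(2)]
      have "0 \<le> L (x / v) / v" using v' L_pos[of "x / v"] by (intro divide_nonneg_pos) auto
      from mult_left_mono[OF y[THEN conjunct1] this] mult_left_mono[OF y[THEN conjunct2] this]
      show ?thesis using assms by (simp add: mult_ac)
    qed
    have up: "integral {a..s} (kern (c * x)) \<le> (1 + e) * A"
      "integral {c * (s / c)..c * (x / a)} (kern (c * x)) \<le> (1 + e) * B"
      using has_integral_le[OF iA' has_integral_mult_right[OF iA]] bA
        has_integral_le[OF iB' has_integral_mult_right[OF iB]] bB by blast+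
    have lo: "(1 - e) * A \<le> integral {a..s} (kern (c * x))"
      "(1 - e) * B \<le> integral {c * (s / c)..c * (x / a)} (kern (c * x))"
      using has_integral_le[OF has_integral_mult_right[OF iA] iA'] bA
        has_integral_le[OF has_integral_mult_right[OF iB] iB'] bB by blast+
    have C': "mult_conv a L (c * x)
        = integral {a..s} (kern (c * x)) + integral {c * (s / c)..c * (x / a)} (kern (c * x))"
      unfolding mult_conv_eq_integral
      using Henstock_Kurzweil_Integration.integral_combine[of a s "c * x / a" "kern (c * x)"]
        kern_integrable[of a "c * x / a" "c * x"] s r(2) xcx assms
      by (simp add: s_def)
    have C: "A + B = mult_conv a L x + integral {s / c..s} (kern x)"
      using Henstock_Kurzweil_Integration.integral_combine[of a s "x / a" "kern x"]
        Henstock_Kurzweil_Integration.integral_combine[of "s / c" s "x / a" "kern x"]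
        kern_integrable[of a "x / a" x] kern_integrable[of "s / c" "x / a" x]
        s r(2) scs sc Y(1)
      by (simp add: s_def A_def B_def mult_conv_eq_integral)
    show ?case
      unfolding s_def[symmetric] C[symmetric] C' distrib_left using up lo by linarith
  qed
qed

lemma mult_conv_ratio_expand:
  assumes "1 < c"
  shows "((\<lambda>x. mult_conv a L (c * x) / mult_conv a L x) \<longlongrightarrow> 1) at_top"
proof (rule tendstoI)
  fix \<epsilon> :: real assume "0 < \<epsilon>"
  \<comment> \<open>The error consists of \<open>J\<close>, \<open>e * C\<close> and
    \<open>e * J\<close>, each at most \<open>e * C\<close>, so it stays below
    \<open>4 * e * C\<close>. The cap 1/2 gives \<open>e < 1\<close>, hence
    \<open>e * J \<le> J\<close>.\<close>
  define e where "e = min (\<epsilon> / 4) (1/2)"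
  have e: "0 < e" "e < 1" "4 * e \<le> \<epsilon>" using \<open>0 < \<epsilon>\<close> by (auto simp: e_def)
  show "\<forall>\<^sub>F x in at_top. dist (mult_conv a L (c * x) / mult_conv a L x) 1 < \<epsilon>"
    using mult_conv_scaled_bounds[OF assms e(1)] middle_block_negligible[OF assms e(1)]
      eventually_gt_at_top[of "a\<^sup>2"] eventually_sqrt_ge[of "c * a"]
  proof eventually_elim
    case (elim x)
    define C C' J where "C = mult_conv a L x" and "C' = mult_conv a L (c * x)"
      and "J = integral {sqrt x / c..sqrt x} (kern x)"
    have C: "0 < C" using mult_conv_pos elim by (simp add: C_def)
    have "1 * a \<le> c * a" using a_pos assms by (intro mult_right_mono) auto
    then have "a \<le> sqrt x" using elim by linarith
    moreover have "a \<le> sqrt x / c" using elim assms by (simp add: field_simps)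
    ultimately have J: "0 \<le> J" "J \<le> e * C"
      using kern_integral_nonneg[of "sqrt x / c" "sqrt x" x] sqrt_in_range[of x] elim
      by (auto simp: J_def C_def)
    have eJ: "e * J \<le> 1 * J" "0 \<le> e * J" using e J by (intro mult_right_mono mult_nonneg_nonneg; simp)+
    have "(1 - e) * (C + J) \<le> C'" "C' \<le> (1 + e) * (C + J)"
      using elim by (auto simp: C_def C'_def J_def)
    then have "C + J - e * C - e * J \<le> C'" "C' \<le> C + J + e * C + e * J"
      by (simp_all add: algebra_simps)
    then have "\<bar>C' - C\<bar> \<le> 3 * (e * C)" using eJ J by linarith
    also have "\<dots> < 4 * e * C" using e C by simp
    also have "\<dots> \<le> \<epsilon> * C" using e C by (intro mult_right_mono) auto
    finally have "\<bar>C' - C\<bar> < \<epsilon> * C" .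
    moreover have "C' / C - 1 = (C' - C) / C" using C by (simp add: field_simps)
    ultimately have "\<bar>C' / C - 1\<bar> < \<epsilon>" using C by (simp add: pos_divide_less_eq)
    then show ?case by (simp add: dist_real_def C_def C'_def)
  qed
qed

lemma mult_conv_ratio:
  assumes "0 < c"
  shows "((\<lambda>x. mult_conv a L (c * x) / mult_conv a L x) \<longlongrightarrow> 1) at_top"
proof -
  consider "1 < c" | "c = 1" | "c < 1" by linarith
  then show ?thesis
  proof cases
    case 1
    then show ?thesis by (rule mult_conv_ratio_expand)
  next
    case 2
    have "\<forall>\<^sub>F x in at_top. mult_conv a L (c * x) / mult_conv a L x = 1"
      using eventually_gt_at_top[of "a\<^sup>2"]
    proof eventually_elim
      case (elim x)
      show ?case using mult_conv_pos[OF elim] 2 by simp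
    qed
    then show ?thesis by (rule tendsto_eventually)
  next
    case 3
    \<comment> \<open>The limit for the factor \<open>1 / c > 1\<close>, taken along
      \<open>c * x\<close>, is the inverse of the desired one.\<close>
    have "filterlim (\<lambda>x. c * x) at_top at_top"
      using assms by (intro filterlim_tendsto_pos_mult_at_top[OF tendsto_const] filterlim_ident)
    from filterlim_compose[OF mult_conv_ratio_expand[of "1 / c"] this]
    have "((\<lambda>x. mult_conv a L x / mult_conv a L (c * x)) \<longlongrightarrow> 1) at_top"
      using assms 3 by simp
    from tendsto_inverse[OF this] show ?thesis by simp
  qed
qed

text \<open>The half-line starts at \<open>a\<^sup>2 + 1\<close> because positivity is available
  only strictly beyond \<open>a\<^sup>2\<close>.\<close>

lemma mult_conv_slowly_varying: "slowly_varying (\<lambda>x. mult_conv a L x)"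
proof -
  have "0 < a\<^sup>2 + 1" using a_pos by (simp add: add_pos_pos)
  moreover have "\<forall>x\<ge>a\<^sup>2 + 1. 0 < mult_conv a L x" using mult_conv_pos by auto
  moreover have "mult_conv a L \<in> borel_measurable (lebesgue_on {a\<^sup>2 + 1..})"
    using mult_conv_borel_measurable
    by (intro measurable_restrict_space1 measurable_completion) simp
  ultimately show ?thesis
    using mult_conv_ratio unfolding slowly_varying_def regularly_varying_def
    by (auto intro!: exI[of _ "a\<^sup>2 + 1"])
qed

end

section \<open>Transfer from the slowly varying factor to the regularly varying function\<close>

text \<open>For large \<open>a\<close> the factorization of \<open>h\<close> holds on all of
  \<open>{a..}\<close>, hence at both \<open>u\<close> and \<open>x / u\<close>. The powers multiply
  to \<open>x powr \<rho>\<close>, which does not depend on \<open>u\<close> and leaves the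
  integral. The integrability claims ensure that no integral is merely the default value 0.\<close>

theorem theorem2:
  fixes h L :: "real \<Rightarrow> real" and \<rho> :: real
  assumes "regularly_varying h \<rho>"
    and "slowly_varying L"
    and "\<forall>\<^sub>F x in at_top. h x = x powr \<rho> * L x"
  shows "\<forall>\<^sub>F a in at_top.
           (\<forall>x\<ge>a.
              set_integrable lebesgue {a..x/a} (\<lambda>u. h u * h (x / u) / u) \<and>
              set_integrable lebesgue {a..x/a} (\<lambda>u. L u * L (x / u) / u) \<and>
              mult_conv a h x = x powr \<rho> * (LINT u:{a..x/a}|lebesgue. L u * L (x / u) / u) \<and>
              x powr \<rho> * (LINT u:{a..x/a}|lebesgue. L u * L (x / u) / u)
                = x powr \<rho> * mult_conv a L x) \<and>
           slowly_varying (\<lambda>x. mult_conv a L x)"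
proof -
  have "\<forall>\<^sub>F a in at_top. \<forall>x\<ge>a. h x = x powr \<rho> * L x"
    using assms(3) by (rule eventually_all_ge_at_top)
  with eventually_slowly_varying_tail[OF assms(2)] show ?thesis
  proof eventually_elim
    case (elim a)
    interpret slowly_varying_tail L a by (rule elim)
    have "set_integrable lebesgue {a..x/a} (\<lambda>u. h u * h (x / u) / u) \<and>
        mult_conv a h x = x powr \<rho> * (LINT u:{a..x/a}|lebesgue. kern x u)" for x
    proof -
      have eq: "h u * h (x / u) / u = x powr \<rho> * kern x u" if u: "u \<in> {a..x/a}" for u
      proof -
        note r = arg_in_range[OF u]
        have "u powr \<rho> * (x / u) powr \<rho> = x powr \<rho>"
          using r by (simp add: powr_divide)
        moreover have "h u = u powr \<rho> * L u" "h (x / u) = (x / u) powr \<rho> * L (x / u)"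
          using elim(2) r u by auto
        ultimately show ?thesis by (simp add: mult_ac)
      qed
      have "set_integrable lebesgue {a..x/a} (\<lambda>u. x powr \<rho> * kern x u)"
        using kern_absolutely_integrable by (rule set_integrable_mult_right)
      then have "set_integrable lebesgue {a..x/a} (\<lambda>u. h u * h (x / u) / u)"
        using eq by (subst set_integrable_cong[OF refl refl]) auto
      moreover have "mult_conv a h x = (LINT u:{a..x/a}|lebesgue. x powr \<rho> * kern x u)"
        unfolding mult_conv_def using eq by (intro set_lebesgue_integral_cong) auto
      ultimately show ?thesis by (simp only: set_integral_mult_right simp_thms)
    qed
    then show ?case
      using kern_absolutely_integrable mult_conv_slowly_varying by (simp add: mult_conv_def)
  qed
qed

end
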